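(* For every integer $n\ge 0$ and real $x\ge 0$, $$\sum_{k=0}^{n}\binom{n}{k}(-1)^k\frac{H_k(x,1)}{\binom{x+k+1}{k}(x+1)}=\frac{1}{(n+x+1)^2},$$ and $$\sum_{k=0}^{n}\binom{n}{k}(-1)^k\frac{H_{k+1}}{k+1}=\frac{1}{(n+1)^2}.$$
   Context: For a positive integer $\alpha$, an integer $n\ge0$ and real $x\ge 0$, $H_n(x,\alpha)=\sum_{k=0}^{n}\frac{1}{(k+x+1)^{\alpha}}$. $H_m=1+\frac12+\cdots+\frac1m$ is the $m$-th harmonic number ($H_0=0$). For real $y$ and integer $k\ge0$, $\binom{y}{k}=\frac{y(y-1)\cdots(y-k+1)}{k!}$, so $\binom{x+k+1}{k}(x+1)=\frac{(x+k+1)(x+k)\cdots(x+1)}{k!}$. *)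

theory Defs
  imports "HOL-Analysis.Harmonic_Numbers"
begin

definition gen_harm :: "nat \<Rightarrow> real \<Rightarrow> nat \<Rightarrow> real" where
  "gen_harm n x \<alpha> = (\<Sum>k=0..n. 1 / (real k + x + 1) ^ \<alpha>)"

end

theory Submission
  imports Defs
begin

text \<open>
  Write \<open>t k x\<close> for the \<open>k\<close>-th quotient in the first sum. It is minus the derivative in \<open>x\<close>
  of the Beta value \<open>k! / ((x + 1) \<cdots> (x + k + 1))\<close>, and like the Beta value it satisfies
  \<open>t k x - t (k + 1) x = t k (x + 1)\<close>. Hence the \<open>n\<close>-th alternating binomial sum, being
  an iterated difference in \<open>k\<close>, equals \<open>t 0 (x + n) = 1 / (x + n + 1)\<^sup>2\<close>. The second
  identity is the case \<open>x = 0\<close>.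
\<close>

text \<open>Pascal's rule splits \<open>Suc n choose Suc k\<close>; the
  \<open>n choose Suc k\<close> part reassembles the sum of order \<open>n\<close> without its
  \<open>k = 0\<close> term, which cancels against \<open>f 0\<close>.\<close>

lemma alternating_binomial_sum_Suc:
  fixes f :: "nat \<Rightarrow> 'a::comm_ring_1"
  shows "(\<Sum>k=0..Suc n. of_nat (Suc n choose k) * (-1) ^ k * f k) =
         (\<Sum>k=0..n. of_nat (n choose k) * (-1) ^ k * (f k - f (Suc k)))"
proof -
  have shift: "(\<Sum>k=0..n. of_nat (n choose Suc k) * (-1) ^ Suc k * f (Suc k)) =
      (\<Sum>k=0..n. of_nat (n choose k) * (-1) ^ k * f k) - f 0"
  proof -
    have "(\<Sum>k=0..Suc n. of_nat (n choose k) * (-1) ^ k * f k) =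
        f 0 + (\<Sum>k=0..n. of_nat (n choose Suc k) * (-1) ^ Suc k * f (Suc k))"
      by (subst sum.atLeast0_atMost_Suc_shift) simp
    moreover have "(\<Sum>k=0..Suc n. of_nat (n choose k) * (-1) ^ k * f k) =
        (\<Sum>k=0..n. of_nat (n choose k) * (-1) ^ k * f k)"
      by (simp add: binomial_eq_0)
    ultimately show ?thesis by (simp only: algebra_simps)
  qed
  have "(\<Sum>k=0..Suc n. of_nat (Suc n choose k) * (-1) ^ k * f k) =
      f 0 + (\<Sum>k=0..n. of_nat (Suc n choose Suc k) * (-1) ^ Suc k * f (Suc k))"
    by (subst sum.atLeast0_atMost_Suc_shift) simp
  also have "(\<Sum>k=0..n. of_nat (Suc n choose Suc k) * (-1) ^ Suc k * f (Suc k)) =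
      (\<Sum>k=0..n. of_nat (n choose Suc k) * (-1) ^ Suc k * f (Suc k)) -
      (\<Sum>k=0..n. of_nat (n choose k) * (-1) ^ k * f (Suc k))"
    unfolding sum_subtractf [symmetric]
    by (rule sum.cong) (simp_all add: algebra_simps)
  finally show ?thesis
    unfolding shift by (simp add: right_diff_distrib sum_subtractf)
qed

text \<open>The binomial contributes \<open>(x + 2) ... (x + k + 1) / k!\<close>, and
  \<open>x + 1\<close> supplies the missing first factor.\<close>

lemma gbinomial_mult_eq_pochhammer:
  fixes x :: "'a::field_char_0"
  shows "((x + of_nat k + 1) gchoose k) * (x + 1) = pochhammer (x + 1) (Suc k) / fact k"
  by (simp add: gbinomial_pochhammer' pochhammer_rec algebra_simps)

text \<open>Split off the first and the last term of \<open>gen_harm (Suc k) x 1\<close> and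
  compare.\<close>

lemma gen_harm_shift:
  "gen_harm k (x + 1) 1 = gen_harm k x 1 - 1 / (x + 1) + 1 / (x + real k + 2)"
proof -
  have "gen_harm (Suc k) x 1 = 1 / (x + 1) + gen_harm k (x + 1) 1"
    unfolding gen_harm_def
    by (subst sum.atLeast0_atMost_Suc_shift) (simp add: algebra_simps)
  moreover have "gen_harm (Suc k) x 1 = gen_harm k x 1 + 1 / (x + real k + 2)"
    by (simp add: gen_harm_def algebra_simps)
  ultimately show ?thesis by simp
qed

lemma gen_harm_gbinomial_quotient_diff:
  fixes x :: real
  assumes "x \<ge> 0"
  defines "t \<equiv> \<lambda>k x. gen_harm k x 1 / (((x + real k + 1) gchoose k) * (x + 1))"
  shows "t k x - t (Suc k) x = t k (x + 1)"
proof -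
  define P where "P = pochhammer (x + 1) (Suc k)"
  define H where "H = gen_harm k x 1"
  define c where "c = x + real k + 2"
  have pos: "P > 0" "x + 1 > 0" "c > 0"
    using assms by (auto simp: P_def c_def intro: pochhammer_pos)
  have t: "t j y = gen_harm j y 1 * fact j / pochhammer (y + 1) (Suc j)" for j y
    unfolding t_def gbinomial_mult_eq_pochhammer by simp
  have P_Suc: "pochhammer (x + 1) (Suc (Suc k)) = P * c"
    unfolding P_def c_def by (subst pochhammer_Suc) (simp add: algebra_simps)
  \<comment> \<open>The same product of \<open>k + 2\<close> factors, now peeled at its first factor
    instead of its last.\<close>
  have "(x + 1) * pochhammer (x + 1 + 1) (Suc k) = P * c"
    unfolding P_Suc [symmetric] by (rule pochhammer_rec [symmetric])
  then have P_shift: "pochhammer (x + 1 + 1) (Suc k) = P * c / (x + 1)"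
    using pos by (simp add: field_simps)
  have H_Suc: "gen_harm (Suc k) x 1 = H + 1 / c"
    by (simp add: gen_harm_def H_def c_def algebra_simps)
  have H_shift: "gen_harm k (x + 1) 1 = H - 1 / (x + 1) + 1 / c"
    unfolding H_def c_def by (rule gen_harm_shift)
  \<comment> \<open>Expressing \<open>k + 1\<close> through \<open>c\<close> and
    \<open>x + 1\<close> leaves a rational identity free of \<open>k\<close>.\<close>
  have k: "real k + 1 = c - (x + 1)"
    by (simp add: c_def)
  have fact_Suc': "(fact (Suc k) :: real) = (c - (x + 1)) * fact k"
    unfolding k [symmetric] by simp
  \<comment> \<open>Used with \<open>a = x + 1\<close> and \<open>F = k!\<close>. Both sides equal
    \<open>F / (P * c)\<close> times \<open>H * a - 1 + a / c\<close>.\<close>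
  have alg: "H * F / P - (H + 1 / c) * ((c - a) * F) / (P * c) =
      (H - 1 / a + 1 / c) * F / (P * c / a)" if "a > 0" for a F :: real
    using pos that by (simp add: divide_simps) (simp add: algebra_simps)
  show ?thesis
    unfolding t P_Suc P_shift H_Suc H_shift fact_Suc' P_def [symmetric] H_def [symmetric]
    by (rule alg) (use pos in simp)
qed

lemma alternating_sum_gen_harm_gbinomial:
  fixes x :: real
  assumes "x \<ge> 0"
  shows "(\<Sum>k=0..n. real (n choose k) * (-1) ^ k *
            (gen_harm k x 1 / (((x + real k + 1) gchoose k) * (x + 1)))) = 1 / (real n + x + 1)\<^sup>2"
  using assms
proof (induction n arbitrary: x)
  case 0
  then show ?case
    by (simp add: gen_harm_def power2_eq_square)
next
  case (Suc n)
  have "x + 1 \<ge> 0" using Suc.prems by simp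
  \<comment> \<open>Differencing in \<open>k\<close> moves \<open>x\<close> to \<open>x + 1\<close>,
    so the hypothesis is needed there; \<open>n + (x + 1) + 1 = Suc n + x + 1\<close> keeps the
    value.\<close>
  from Suc.IH [OF this] show ?case
    unfolding alternating_binomial_sum_Suc gen_harm_gbinomial_quotient_diff [OF Suc.prems]
    by (simp add: algebra_simps)
qed

lemma gen_harm_0_eq_harm: "gen_harm k 0 1 = harm (k + 1)"
  by (induction k) (simp_all add: gen_harm_def harm_Suc harm_expand(1) inverse_eq_divide add.commute)

theorem theorem2p2:
  fixes n :: nat and x :: real
  assumes "x \<ge> 0"
  shows "(\<Sum>k=0..n. real (n choose k) * (-1) ^ k *
            (gen_harm k x 1 / (((x + real k + 1) gchoose k) * (x + 1)))) = 1 / (real n + x + 1)\<^sup>2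
       \<and> (\<Sum>k=0..n. real (n choose k) * (-1) ^ k *
            (harm (k + 1) / (real k + 1))) = 1 / (real n + 1)\<^sup>2"
proof
  \<comment> \<open>At \<open>x = 0\<close> the rising factorial is \<open>(k + 1)!\<close>, and
    dividing by \<open>k!\<close> leaves \<open>k + 1\<close>.\<close>
  have "((0 + real k + 1) gchoose k) * (0 + 1) = real k + 1" for k
    unfolding gbinomial_mult_eq_pochhammer
    by (simp only: add_0 pochhammer_fact [symmetric]) simp
  then show "(\<Sum>k=0..n. real (n choose k) * (-1) ^ k *
      (harm (k + 1) / (real k + 1))) = 1 / (real n + 1)\<^sup>2"
    using alternating_sum_gen_harm_gbinomial [of 0 n]
    by (simp only: gen_harm_0_eq_harm add_0_right order_refl simp_thms)
qed (rule alternating_sum_gen_harm_gbinomial [OF assms])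

end
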